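(* Let $q,q_1\in(0,1)$ with $q\neq q_1$, and let $T$ be a prefix code (tree) that is optimal for $\mathrm{TDGD}(q)$. Then $T$ is not optimal for $\mathrm{TDGD}(q_1)$.
   Context: Let $\mathcal{A}=\{(i,j): i,j\in\mathbb{Z}_{\ge 0}\}$. For $0<q<1$, $\mathrm{TDGD}(q)$ (two-dimensional geometric distribution) is the distribution on $\mathcal{A}$ given by $P(i,j)=(1-q)^2q^{i+j}$. A binary prefix code for $\mathcal{A}$ is identified with a (possibly infinite) full binary tree (every node is either a leaf or has exactly two children) whose leaves are in bijection with $\mathcal{A}$; the codeword length of a symbol is the depth of its leaf. A code is optimal for $\mathrm{TDGD}(q)$ if its expected codeword length $\sum_{(i,j)}P(i,j)\,\ell(i,j)$ is minimal among all binary prefix codes for $\mathcal{A}$. *)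

theory Defs
  imports "HOL-Analysis.Analysis" "HOL-Library.Sublist"
begin

text \<open>A binary prefix code for the alphabet nat x nat, given by its codeword map.
  Codewords are the leaves of a full binary tree (every internal node on a path to a
  leaf has both children), leaves in bijection with the alphabet.\<close>
definition full_prefix_code :: "(nat \<times> nat \<Rightarrow> bool list) \<Rightarrow> bool" where
  "full_prefix_code c \<longleftrightarrow>
     (\<forall>a b. a \<noteq> b \<longrightarrow> \<not> prefix (c a) (c b)) \<and>
     (\<forall>a p. strict_prefix p (c a) \<longrightarrow>
        (\<forall>x::bool. \<exists>b. prefix (p @ [x]) (c b)))"

definition tdgd :: "real \<Rightarrow> nat \<times> nat \<Rightarrow> real" where
  "tdgd q = (\<lambda>(i,j). (1 - q)^2 * q^(i + j))"

definition exp_len :: "real \<Rightarrow> (nat \<times> nat \<Rightarrow> bool list) \<Rightarrow> ennreal" where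
  "exp_len q c = (\<integral>\<^sup>+ s. ennreal (tdgd q s * real (length (c s))) \<partial>count_space UNIV)"

definition optimal_code :: "real \<Rightarrow> (nat \<times> nat \<Rightarrow> bool list) \<Rightarrow> bool" where
  "optimal_code q c \<longleftrightarrow> full_prefix_code c \<and>
     (\<forall>c'. full_prefix_code c' \<longrightarrow> exp_len q c \<le> exp_len q c')"

end

theory Submission
  imports Defs
begin

text \<open>
  By Kraft's inequality and its converse, optimality only concerns the codeword lengths: a finite
  modification of the lengths that does not increase the Kraft sum cannot lower the cost. Hence all
  symbols of signature \<open>i + j = s\<close> have lengths within 2 of each other. Lengthening \<open>2\<^sup>k\<close> symbols
  of signature \<open>s\<close> while shortening one symbol of signature \<open>t\<close>, or vice versa, shows that
  \<open>2\<^sup>k q\<^sup>s < q\<^sup>t\<close> forces the length to grow by at least \<open>k - O(1)\<close> from signature \<open>t\<close> to \<open>s\<close>, and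
  \<open>2\<^sup>k q\<^sup>s > q\<^sup>t\<close> forces it to grow by at most \<open>k + O(1)\<close>. As there are \<open>s + 1\<close> symbols of signature
  \<open>s\<close>, \<open>k\<close> may be arbitrarily large, so the growth rate of the lengths, \<open>log\<^sub>2 (1/q)\<close>, determines \<open>q\<close>.
\<close>

section \<open>Kraft's inequality and its converse\<close>

definition prefix_free :: "('a \<Rightarrow> 'b list) \<Rightarrow> bool" where
  "prefix_free c \<longleftrightarrow> (\<forall>a b. a \<noteq> b \<longrightarrow> \<not> prefix (c a) (c b))"

lemma prefix_freeD: "prefix_free c \<Longrightarrow> a \<noteq> b \<Longrightarrow> \<not> prefix (c a) (c b)"
  by (simp add: prefix_free_def)

text \<open>Pad all codewords of \<open>F\<close> to a common length \<open>N\<close>.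
  Prefix-freeness makes the sets \<open>E a\<close> of padded words disjoint, and together they fit
  into the \<open>2 ^ N\<close> words of length \<open>N\<close>.\<close>

lemma kraft_inequality:
  fixes c :: "'a \<Rightarrow> bool list"
  assumes pf: "prefix_free c" and F: "finite F"
  shows "(\<Sum>a\<in>F. (1/2) ^ length (c a)) \<le> (1::real)"
proof -
  define N where "N = Max (insert 0 ((\<lambda>a. length (c a)) ` F))"
  have N: "length (c a) \<le> N" if "a \<in> F" for a
    unfolding N_def using F that by (intro Max_ge) auto
  define E where "E a = (\<lambda>v. c a @ v) ` {v::bool list. length v = N - length (c a)}" for a
  have fin: "finite {v::bool list. length v = n}" for n
    using finite_lists_length_eq[of "UNIV :: bool set" n] by simp
  have cardL: "card {v::bool list. length v = n} = 2 ^ n" for n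
    using card_lists_length_eq[of "UNIV :: bool set" n] by simp
  have finE: "finite (E a)" for a
    unfolding E_def using fin by blast
  have cardE: "card (E a) = 2 ^ (N - length (c a))" for a
    unfolding E_def by (subst card_image) (auto simp: inj_on_def cardL)
  have disj: "E a \<inter> E b = {}" if "a \<noteq> b" for a b
  proof (rule ccontr)
    assume "E a \<inter> E b \<noteq> {}"
    then obtain w where "prefix (c a) w" "prefix (c b) w"
      unfolding E_def by (metis (no_types, lifting) Int_iff ex_in_conv image_iff prefixI)
    then have "prefix (c a) (c b) \<or> prefix (c b) (c a)"
      by (metis prefix_same_cases)
    with pf that show False unfolding prefix_free_def by metis
  qed
  have "(\<Union>a\<in>F. E a) \<subseteq> {v. length v = N}"
    unfolding E_def using N by auto
  then have "card (\<Union>a\<in>F. E a) \<le> 2 ^ N"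
    using card_mono[OF fin] cardL by metis
  moreover have "card (\<Union>a\<in>F. E a) = (\<Sum>a\<in>F. 2 ^ (N - length (c a)))"
    using F finE disj cardE by (subst card_UN_disjoint) auto
  ultimately have "real (\<Sum>a\<in>F. 2 ^ (N - length (c a))) \<le> 2 ^ N"
    by (metis of_nat_le_iff of_nat_numeral of_nat_power)
  moreover have "real (\<Sum>a\<in>F. 2 ^ (N - length (c a))) = (2::real) ^ N * (\<Sum>a\<in>F. (1/2) ^ length (c a))"
    unfolding of_nat_sum sum_distrib_left
    by (intro sum.cong) (simp_all add: power_diff[where 'a = real] N power_divide)
  ultimately show ?thesis by simp
qed

fun bits :: "nat \<Rightarrow> nat \<Rightarrow> bool list" where
  "bits 0 i = []"
| "bits (Suc n) i = bits n (i div 2) @ [odd i]"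

lemma length_bits [simp]: "length (bits n i) = n"
  by (induction n arbitrary: i) auto

text \<open>Dropping the last \<open>d\<close> bits is division by \<open>2 ^ d\<close>; this turns
  the prefix relation between expansions into an equation between numbers.\<close>

lemma take_bits: "take n (bits (n + d) i) = bits n (i div 2 ^ d)"
  by (induction d arbitrary: i) (auto simp: div_mult2_eq)

lemma bits_inject: "i < 2 ^ n \<Longrightarrow> j < 2 ^ n \<Longrightarrow> bits n i = bits n j \<Longrightarrow> i = j"
proof (induction n arbitrary: i j)
  case (Suc n)
  then have "i div 2 = j div 2" "odd i = odd j" by auto
  then show ?case by (metis dvd_div_mult_self odd_two_times_div_two_succ mult.commute)
qed simp

text \<open>The code is canonical: the words of length \<open>n\<close> are the \<open>n\<close>-bit expansions of consecutive
  numbers starting at \<open>s n\<close>, the number of words of length \<open>n\<close> that extend a shorter codeword.\<close>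

lemma kraft_converse:
  fixes l :: "'a \<Rightarrow> nat"
  assumes kraft: "\<And>F. finite F \<Longrightarrow> (\<Sum>a\<in>F. (1/2) ^ l a) \<le> (1::real)"
  shows "\<exists>c :: 'a \<Rightarrow> bool list. prefix_free c \<and> (\<forall>a. length (c a) = l a)"
proof -
  define A where "A n = {a. l a = n}" for n
  have finA: "finite (A n)" for n
  proof (rule ccontr)
    \<comment> \<open>Already \<open>2 ^ n + 1\<close> symbols of length \<open>n\<close> have Kraft
      sum above 1.\<close>
    assume "infinite (A n)"
    then obtain F where F: "finite F" "F \<subseteq> A n" "card F = Suc (2 ^ n)"
      using infinite_arbitrarily_large by blast
    have "(\<Sum>a\<in>F. (1/2) ^ l a) = (\<Sum>a\<in>F. (1/2) ^ n :: real)"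
      using F by (intro sum.cong) (auto simp: A_def)
    also have "\<dots> = real (Suc (2 ^ n)) * (1/2) ^ n" using F by simp
    also have "\<dots> > 1" by (simp add: field_simps)
    finally show False using kraft[OF F(1)] by simp
  qed
  define s where "s = rec_nat 0 (\<lambda>n x. 2 * (x + card (A n)))"
  have s0: "s 0 = 0" and sS: "s (Suc n) = 2 * (s n + card (A n))" for n
    by (simp_all add: s_def)
  \<comment> \<open>\<open>s n / 2 ^ n\<close> is the Kraft sum of all symbols of length below
    \<open>n\<close>, so the Kraft bound leaves room for \<open>A n\<close> at level
    \<open>n\<close>.\<close>
  have s_sum: "real (s n) = 2 ^ n * (\<Sum>m<n. real (card (A m)) * (1/2) ^ m)" for n
    by (induction n) (auto simp: s0 sS algebra_simps power_divide)
  have s_le: "s n + card (A n) \<le> 2 ^ n" for n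
  proof -
    have "(\<Sum>m\<le>n. real (card (A m)) * (1/2) ^ m) = (\<Sum>m\<le>n. \<Sum>a\<in>A m. (1/2) ^ l a)"
      by (intro sum.cong) (auto simp: A_def)
    also have "\<dots> = (\<Sum>a\<in>(\<Union>m\<le>n. A m). (1/2) ^ l a)"
      using finA by (subst sum.UNION_disjoint) (auto simp: A_def)
    also have "\<dots> \<le> 1" using finA by (intro kraft) auto
    finally have "(\<Sum>m<Suc n. real (card (A m)) * (1/2) ^ m) \<le> 1"
      by (simp only: lessThan_Suc_atMost)
    then have "real (s (Suc n)) \<le> 2 ^ Suc n"
      unfolding s_sum by simp
    then show ?thesis unfolding sS
      by (metis mult_le_cancel1 of_nat_le_iff of_nat_numeral of_nat_power power_Suc zero_less_numeral)
  qed
  \<comment> \<open>The descendants at level \<open>n + d\<close> of the first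
    \<open>s n + card (A n)\<close> nodes of level \<open>n\<close> have numbers below the left-hand
    side, and the codewords of level \<open>n + d\<close> start no earlier. For \<open>d = 0\<close>
    this would fail whenever \<open>A n\<close> is nonempty, so equal lengths are treated separately
    below, by injectivity of \<open>e\<close>.\<close>
  have s_mono: "2 ^ d * (s n + card (A n)) \<le> s (n + d)" if "d > 0" for n d
    using that
  proof (induction d)
    case (Suc d)
    then show ?case by (cases "d = 0") (auto simp: sS)
  qed simp
  have "\<exists>e. bij_betw e (A n) {0..<card (A n)}" for n
    using ex_bij_betw_finite_nat[OF finA] by blast
  then obtain e where e: "\<And>n. bij_betw (e n) (A n) {0..<card (A n)}" by metis
  define k where "k a = s (l a) + e (l a) a" for a
  have k_less: "k a < s (l a) + card (A (l a))" for a
    using bij_betwE[OF e[of "l a"]] by (auto simp: k_def A_def)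
  define c where "c a = bits (l a) (k a)" for a
  have "\<not> prefix (c a) (c b)" if ab: "a \<noteq> b" for a b
  proof
    assume p: "prefix (c a) (c b)"
    then have "l a \<le> l b" using prefix_length_le[OF p] by (simp add: c_def)
    then obtain d where d: "l b = l a + d" using le_Suc_ex by blast
    have "c a = take (l a) (c b)"
      using p by (auto simp: prefix_def c_def)
    then have "bits (l a) (k a) = bits (l a) (k b div 2 ^ d)"
      by (simp add: c_def d take_bits)
    moreover have "k a < 2 ^ l a" "k b < 2 ^ (l a + d)"
      using k_less[of a] s_le[of "l a"] k_less[of b] s_le[of "l b"] d by auto
    ultimately have k: "k a = k b div 2 ^ d"
      by (intro bits_inject) (auto simp: power_add less_mult_imp_div_less)
    show False
    proof (cases "d = 0")
      case True
      then have "e (l a) a = e (l a) b" using k d by (simp add: k_def)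
      moreover have "a \<in> A (l a)" "b \<in> A (l a)" using True d by (auto simp: A_def)
      ultimately show False using e[of "l a"] ab by (auto simp: bij_betw_def inj_on_def)
    next
      case False
      then have "2 ^ d * (s (l a) + card (A (l a))) \<le> k b"
        using s_mono[of d "l a"] d by (simp add: k_def)
      then have "s (l a) + card (A (l a)) \<le> k b div 2 ^ d"
        by (simp add: less_eq_div_iff_mult_less_eq mult.commute)
      with k k_less[of a] show False by simp
    qed
  qed
  then show ?thesis by (intro exI[of _ c]) (auto simp: prefix_free_def c_def)
qed

section \<open>From prefix-free codes to full trees\<close>

text \<open>Contracts every node that has a single child; \<open>B\<close> is the set of branching nodes and
  \<open>p\<close> the part of the word already read.\<close>

fun prune :: "bool list set \<Rightarrow> bool list \<Rightarrow> bool list \<Rightarrow> bool list" where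
  "prune B p [] = []"
| "prune B p (x # w) = (if p \<in> B then [x] else []) @ prune B (p @ [x]) w"

lemma prune_append: "prune B p (v @ w) = prune B p v @ prune B (p @ v) w"
  by (induction v arbitrary: p) auto

lemma length_prune_le: "length (prune B p w) \<le> length w"
  by (induction w arbitrary: p) (auto intro: le_SucI)

text \<open>Each letter that survives pruning was read at a node of \<open>B\<close>. A proper
  prefix of the pruned word stops just before such a letter, hence at the image of a branching
  node.\<close>

lemma strict_prefix_pruneD:
  "strict_prefix r (prune B p w) \<Longrightarrow>
    \<exists>v. strict_prefix v w \<and> p @ v \<in> B \<and> r = prune B p v"
proof (induction w arbitrary: p r)
  case (Cons x w)
  show ?case
  proof (cases "p \<in> B \<and> r = []")
    case True
    then show ?thesis by (intro exI[of _ "[]"]) auto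
  next
    case False
    define r' where "r' = (if p \<in> B then tl r else r)"
    have r: "r = (if p \<in> B then [x] else []) @ r'"
      using False Cons.prems by (cases r) (auto simp: r'_def)
    with Cons.prems have "strict_prefix r' (prune B (p @ [x]) w)"
      by (auto split: if_splits)
    from Cons.IH[OF this] obtain v where
      "strict_prefix v w" "p @ x # v \<in> B" "r' = prune B (p @ [x]) v" by auto
    then show ?thesis using r by (intro exI[of _ "x # v"]) auto
  qed
qed simp

text \<open>The node at which two codewords diverge is branching, so pruning keeps both diverging
  letters and the code stays prefix-free. Every internal node of the pruned tree comes from a
  branching node, so the tree is full.\<close>

lemma prefix_free_imp_full_prefix_code:
  fixes c :: "nat \<times> nat \<Rightarrow> bool list"
  assumes pf: "prefix_free c"
  obtains c' where "full_prefix_code c'" "\<And>a. length (c' a) \<le> length (c a)"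
proof -
  define B where "B = {p. \<forall>x. \<exists>b. prefix (p @ [x]) (c b)}"
  define c' where "c' a = prune B [] (c a)" for a
  have step: "prefix (prune B [] p @ [x]) (c' b)" if "p \<in> B" "prefix (p @ [x]) (c b)" for p x b
    using that by (auto simp: c'_def prefix_def prune_append)
  have "\<not> prefix (c' a) (c' b)" if "a \<noteq> b" for a b
  proof -
    have "parallel (c a) (c b)"
      by (rule parallelI[OF prefix_freeD[OF pf that] prefix_freeD[OF pf that[symmetric]]])
    from parallel_decomp[OF this] obtain p x v y w
      where d: "x \<noteq> y" "c a = p @ x # v" "c b = p @ y # w" by auto
    then have pre: "prefix (p @ [x]) (c a)" "prefix (p @ [y]) (c b)"
      by auto
    have "p \<in> B"
      unfolding B_def
    proof (intro CollectI allI)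
      fix z
      have "z = x \<or> z = y" using d(1) by auto
      then show "\<exists>b. prefix (p @ [z]) (c b)"
      proof
        assume "z = x" with pre(1) show ?thesis by (intro exI[of _ a]) simp
      next
        assume "z = y" with pre(2) show ?thesis by (intro exI[of _ b]) simp
      qed
    qed
    from step[OF this pre(1)] step[OF this pre(2)] d(1) show ?thesis
      by (auto simp: prefix_def)
  qed
  moreover have "\<exists>b. prefix (r @ [x]) (c' b)" if "strict_prefix r (c' a)" for a r x
  proof -
    from strict_prefix_pruneD[OF that[unfolded c'_def]]
    obtain v where v: "v \<in> B" "r = prune B [] v" by auto
    from v(1) have "\<forall>x. \<exists>b. prefix (v @ [x]) (c b)" unfolding B_def by (rule CollectD)
    then obtain b where "prefix (v @ [x]) (c b)" by metis
    from step[OF v(1) this] show ?thesis unfolding v(2) by (rule exI)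
  qed
  ultimately have "full_prefix_code c'" by (auto simp: full_prefix_code_def)
  moreover have "length (c' a) \<le> length (c a)" for a
    by (simp add: c'_def length_prune_le)
  ultimately show ?thesis using that by blast
qed

section \<open>Finiteness of the optimal cost\<close>

lemma full_prefix_codeD: "full_prefix_code c \<Longrightarrow> prefix_free c"
  by (simp add: full_prefix_code_def prefix_free_def)

lemma prefix_free_length_pos:
  assumes "prefix_free c" "a \<noteq> b"
  shows "length (c a) \<ge> 1"
  using assms unfolding prefix_free_def by (metis One_nat_def Suc_leI length_greater_0_conv Nil_prefix)

lemma prefix_free_unary_pairs:
  "prefix_free (\<lambda>(i, j). replicate i True @ False # replicate j True @ [False])"
proof -
  have *: "i = i' \<and> v = v'"
    if "replicate i True @ False # v = replicate i' True @ False # v'" for i i' v v'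
    using that
  proof (induction i arbitrary: i')
    case 0 then show ?case by (cases i') auto
  next
    case (Suc i) then show ?case by (cases i') auto
  qed
  show ?thesis unfolding prefix_free_def prefix_def
    by (auto dest!: *)
qed

text \<open>Compare with the unary pair code of lengths \<open>i + j + 2\<close>. Since
  \<open>i + j + 2\<close> is at most \<open>2 * (i + 1) * (j + 1)\<close>, its cost is bounded by
  twice the square of a convergent series. Finiteness is what later allows the common tail of two
  costs to be cancelled.\<close>

lemma optimal_code_finite:
  assumes q: "0 < q" "q < 1" and opt: "optimal_code q T"
  shows "exp_len q T < \<infinity>"
proof -
  define u :: "nat \<times> nat \<Rightarrow> bool list" where
    "u = (\<lambda>(i, j). replicate i True @ False # replicate j True @ [False])"
  obtain c where c: "full_prefix_code c" "\<And>a. length (c a) \<le> length (u a)"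
    using prefix_free_imp_full_prefix_code[OF prefix_free_unary_pairs] unfolding u_def by metis
  define g where "g i = ennreal (real (Suc i) * q ^ i)" for i
  have "(\<lambda>i. real (Suc i) * q ^ i) sums (1 / (1 - q)\<^sup>2)"
    using geometric_deriv_sums[of q] q by simp
  then have "(\<integral>\<^sup>+ i. g i \<partial>count_space UNIV) = ennreal (1 / (1 - q)\<^sup>2)"
    unfolding g_def nn_integral_count_space_nat using q
    by (subst suminf_ennreal_eq) auto
  then have fin: "(\<integral>\<^sup>+ i. g i \<partial>count_space UNIV) < \<infinity>" by simp
  have le: "ennreal (tdgd q s * real (length (c s))) \<le> 2 * (g (fst s) * g (snd s))" for s
  proof (cases s)
    case (Pair i j)
    have "real (length (c s)) \<le> real (i + j + 2)"
      using c(2)[of s] by (simp add: Pair u_def)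
    also have "\<dots> \<le> 2 * (real (Suc i) * real (Suc j))"
      by (simp add: algebra_simps)
    finally have 1: "real (length (c s)) \<le> 2 * (real (Suc i) * real (Suc j))" .
    have "(1 - q)\<^sup>2 \<le> 1" using q by (simp add: power_le_one)
    then have 2: "tdgd q s \<le> q ^ i * q ^ j"
      using q mult_right_mono[of "(1-q)\<^sup>2" 1 "q ^ (i+j)"] by (simp add: tdgd_def Pair power_add)
    have "tdgd q s * real (length (c s)) \<le> (q ^ i * q ^ j) * (2 * (real (Suc i) * real (Suc j)))"
      using q by (intro mult_mono 1 2) auto
    also have "\<dots> = 2 * ((real (Suc i) * q ^ i) * (real (Suc j) * q ^ j))"
      by (simp add: mult_ac)
    finally have "ennreal (tdgd q s * real (length (c s))) \<le>
        ennreal (2 * ((real (Suc i) * q ^ i) * (real (Suc j) * q ^ j)))"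
      by (rule ennreal_leI)
    also have "\<dots> = 2 * (g i * g j)"
      using q by (simp add: g_def ennreal_mult del: of_nat_Suc)
    finally show ?thesis by (simp add: Pair)
  qed
  have "exp_len q T \<le> exp_len q c"
    using opt c(1) by (simp add: optimal_code_def)
  also have "\<dots> \<le> (\<integral>\<^sup>+ s. 2 * (g (fst s) * g (snd s)) \<partial>count_space UNIV)"
    unfolding exp_len_def by (intro nn_integral_mono le)
  also have "\<dots> = 2 * (\<integral>\<^sup>+ i. \<integral>\<^sup>+ j. g i * g j \<partial>count_space UNIV \<partial>count_space UNIV)"
    by (subst nn_integral_cmult, simp, subst nn_integral_fst_count_space[symmetric], simp)
  also have "\<dots> = 2 * ((\<integral>\<^sup>+ i. g i \<partial>count_space UNIV) * (\<integral>\<^sup>+ j. g j \<partial>count_space UNIV))"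
    by (simp add: nn_integral_cmult nn_integral_multc)
  also have "\<dots> < \<infinity>" using fin by (simp add: ennreal_mult_less_top)
  finally show ?thesis .
qed

section \<open>Finite changes of the codeword lengths\<close>

lemma exp_len_split:
  fixes l :: "nat \<times> nat \<Rightarrow> nat"
  assumes q: "0 < q" "q < 1" and D: "finite D"
  shows "(\<integral>\<^sup>+ s. ennreal (tdgd q s * real (l s)) \<partial>count_space UNIV) =
    ennreal (\<Sum>s\<in>D. tdgd q s * real (l s)) +
    (\<integral>\<^sup>+ s. ennreal (tdgd q s * real (l s)) * indicator (- D) s \<partial>count_space UNIV)"
proof -
  define f where "f s = ennreal (tdgd q s * real (l s))" for s
  have pos: "tdgd q s * real (l s) \<ge> 0" for s
    using q by (auto simp: tdgd_def split: prod.split)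
  have "(\<integral>\<^sup>+ s. f s \<partial>count_space UNIV) =
      (\<integral>\<^sup>+ s. f s * indicator D s + f s * indicator (- D) s \<partial>count_space UNIV)"
    by (intro nn_integral_cong) (auto simp: indicator_def)
  also have "\<dots> = (\<integral>\<^sup>+ s. f s * indicator D s \<partial>count_space UNIV) +
      (\<integral>\<^sup>+ s. f s * indicator (- D) s \<partial>count_space UNIV)"
    by (intro nn_integral_add) auto
  also have "(\<integral>\<^sup>+ s. f s * indicator D s \<partial>count_space UNIV) = (\<Sum>s\<in>D. f s)"
    using D by (simp add: nn_integral_count_space_indicator[symmetric] nn_integral_count_space_finite)
  also have "\<dots> = ennreal (\<Sum>s\<in>D. tdgd q s * real (l s))"
    unfolding f_def using pos by (simp add: sum_ennreal)
  finally show ?thesis by (simp add: f_def)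
qed

text \<open>The new lengths still satisfy Kraft's inequality, so some prefix-free code realises
  them, and pruning it to a full tree only shortens words. Outside \<open>D\<close> both costs have
  the same finite tail \<open>R\<close>, which cancels.\<close>

lemma optimal_code_finite_change:
  fixes l :: "nat \<times> nat \<Rightarrow> nat"
  assumes q: "0 < q" "q < 1" and opt: "optimal_code q T" and D: "finite D"
    and out: "\<And>a. a \<notin> D \<Longrightarrow> l a = length (T a)"
    and kraft: "(\<Sum>a\<in>D. (1/2) ^ l a) \<le> (\<Sum>a\<in>D. (1/2) ^ length (T a) :: real)"
  shows "(\<Sum>a\<in>D. tdgd q a * real (length (T a))) \<le> (\<Sum>a\<in>D. tdgd q a * real (l a))"
proof -
  have pf: "prefix_free T"
    using opt by (simp add: optimal_code_def full_prefix_codeD)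
  have l_kraft: "(\<Sum>a\<in>F. (1/2) ^ l a) \<le> (1::real)" if F: "finite F" for F
  proof -
    have "(\<Sum>a\<in>F. (1/2) ^ l a :: real) \<le> (\<Sum>a\<in>F \<union> D. (1/2) ^ l a)"
      using F D by (intro sum_mono2) auto
    also have "\<dots> = (\<Sum>a\<in>D. (1/2) ^ l a) + (\<Sum>a\<in>F - D. (1/2) ^ l a)"
      using F D by (metis Diff_disjoint Un_Diff_cancel finite_Diff sup_commute sum.union_disjoint)
    also have "\<dots> \<le> (\<Sum>a\<in>D. (1/2) ^ length (T a)) + (\<Sum>a\<in>F - D. (1/2) ^ length (T a))"
      using kraft out by (intro add_mono) auto
    also have "\<dots> = (\<Sum>a\<in>F \<union> D. (1/2) ^ length (T a))"
      using F D by (metis Diff_disjoint Un_Diff_cancel finite_Diff sup_commute sum.union_disjoint)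
    also have "\<dots> \<le> 1" using F D by (intro kraft_inequality pf) auto
    finally show ?thesis .
  qed
  have "\<exists>c0 :: nat \<times> nat \<Rightarrow> bool list. prefix_free c0 \<and> (\<forall>a. length (c0 a) = l a)"
    by (rule kraft_converse) (rule l_kraft)
  then obtain c0 :: "nat \<times> nat \<Rightarrow> bool list"
    where c0: "prefix_free c0" "\<And>a. length (c0 a) = l a"
    by metis
  obtain c where c: "full_prefix_code c" "\<And>a. length (c a) \<le> l a"
    using prefix_free_imp_full_prefix_code[OF c0(1)] c0(2) by metis
  define R where "R = (\<integral>\<^sup>+ s. ennreal (tdgd q s * real (length (T s))) * indicator (- D) s \<partial>count_space UNIV)"
  have R: "R = (\<integral>\<^sup>+ s. ennreal (tdgd q s * real (l s)) * indicator (- D) s \<partial>count_space UNIV)"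
    unfolding R_def by (intro nn_integral_cong) (auto simp: indicator_def out)
  have td: "tdgd q s \<ge> 0" for s
    using q by (auto simp: tdgd_def split: prod.split)
  have T: "exp_len q T = ennreal (\<Sum>s\<in>D. tdgd q s * real (length (T s))) + R"
    unfolding exp_len_def R_def by (rule exp_len_split[OF q D])
  have "exp_len q T \<le> exp_len q c"
    using opt c(1) by (simp add: optimal_code_def)
  also have "\<dots> \<le> (\<integral>\<^sup>+ s. ennreal (tdgd q s * real (l s)) \<partial>count_space UNIV)"
    unfolding exp_len_def using c(2) td
    by (intro nn_integral_mono ennreal_leI mult_left_mono) auto
  also have "\<dots> = ennreal (\<Sum>s\<in>D. tdgd q s * real (l s)) + R"
    unfolding R by (rule exp_len_split[OF q D])
  finally have "R + ennreal (\<Sum>s\<in>D. tdgd q s * real (length (T s))) \<le>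
      R + ennreal (\<Sum>s\<in>D. tdgd q s * real (l s))"
    unfolding T by (simp add: add.commute)
  moreover have "R \<noteq> \<infinity>"
    using optimal_code_finite[OF q opt] unfolding T by auto
  ultimately have "ennreal (\<Sum>s\<in>D. tdgd q s * real (length (T s))) \<le>
      ennreal (\<Sum>s\<in>D. tdgd q s * real (l s))"
    by (auto simp: ennreal_add_left_cancel_le)
  then show ?thesis
    using td by (subst (asm) ennreal_le_iff) (auto intro: sum_nonneg)
qed

text \<open>Lengthening \<open>U\<close> by one bit frees half of its Kraft weight; shortening
  \<open>V\<close> by \<open>d\<close> bits uses \<open>2 ^ d - 1\<close> times the weight of
  \<open>V\<close>. If the freed weight suffices, optimality says that the saving on
  \<open>V\<close> is at most the loss on \<open>U\<close>. The assumption on \<open>d\<close> keeps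
  the natural-number subtraction exact.\<close>

lemma optimal_code_exchange:
  fixes U V :: "(nat \<times> nat) set"
  assumes q: "0 < q" "q < 1" and opt: "optimal_code q T"
    and fin: "finite U" "finite V" and disj: "U \<inter> V = {}"
    and d: "\<And>a. a \<in> V \<Longrightarrow> d \<le> length (T a)"
    and kraft: "(2 ^ d - 1) * (\<Sum>a\<in>V. (1/2) ^ length (T a)) \<le> (\<Sum>a\<in>U. (1/2) ^ length (T a)) / (2::real)"
  shows "real d * (\<Sum>a\<in>V. q ^ (fst a + snd a)) \<le> (\<Sum>a\<in>U. q ^ (fst a + snd a))"
proof -
  define l where "l a = (if a \<in> U then length (T a) + 1 else
    if a \<in> V then length (T a) - d else length (T a))" for a
  have lU: "l a = length (T a) + 1" if "a \<in> U" for a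
    using that by (simp add: l_def)
  have lV: "l a = length (T a) - d" if "a \<in> V" for a
    using that disj by (auto simp: l_def)
  have split: "sum f (U \<union> V) = sum f U + sum f V" for f :: "nat \<times> nat \<Rightarrow> real"
    using fin disj by (rule sum.union_disjoint)
  have kU: "(\<Sum>a\<in>U. (1/2) ^ l a) = (\<Sum>a\<in>U. (1/2) ^ length (T a)) / (2::real)"
    unfolding sum_divide_distrib by (intro sum.cong) (auto simp: lU)
  have kV: "(\<Sum>a\<in>V. (1/2) ^ l a) = 2 ^ d * (\<Sum>a\<in>V. (1/2) ^ length (T a) :: real)"
    unfolding sum_distrib_left
    by (intro sum.cong) (auto simp: lV d power_diff power_divide)
  have "(\<Sum>a\<in>U \<union> V. tdgd q a * real (length (T a))) \<le> (\<Sum>a\<in>U \<union> V. tdgd q a * real (l a))"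
  proof (rule optimal_code_finite_change[OF q opt])
    show "(\<Sum>a\<in>U \<union> V. (1/2) ^ l a) \<le> (\<Sum>a\<in>U \<union> V. (1/2) ^ length (T a) :: real)"
      unfolding split kU kV using kraft by (simp add: algebra_simps)
  qed (use fin in \<open>auto simp: l_def\<close>)
  moreover have "(\<Sum>a\<in>U. tdgd q a * real (l a)) =
      (\<Sum>a\<in>U. tdgd q a * real (length (T a))) + (\<Sum>a\<in>U. tdgd q a)"
    unfolding sum.distrib[symmetric] by (intro sum.cong) (auto simp: lU algebra_simps)
  moreover have "(\<Sum>a\<in>V. tdgd q a * real (l a)) =
      (\<Sum>a\<in>V. tdgd q a * real (length (T a))) - real d * (\<Sum>a\<in>V. tdgd q a)"
    unfolding sum_distrib_left sum_subtractf[symmetric]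
    by (intro sum.cong) (auto simp: lV d of_nat_diff algebra_simps)
  ultimately have "real d * (\<Sum>a\<in>V. tdgd q a) \<le> (\<Sum>a\<in>U. tdgd q a)"
    unfolding split by simp
  moreover have "(\<Sum>a\<in>W. tdgd q a) = (1 - q)\<^sup>2 * (\<Sum>a\<in>W. q ^ (fst a + snd a))" for W
    unfolding sum_distrib_left by (simp add: tdgd_def case_prod_beta)
  ultimately have "(1 - q)\<^sup>2 * (real d * (\<Sum>a\<in>V. q ^ (fst a + snd a))) \<le>
      (1 - q)\<^sup>2 * (\<Sum>a\<in>U. q ^ (fst a + snd a))"
    by (simp add: mult_ac)
  then show ?thesis
    using q by (subst (asm) mult_le_cancel_left_pos) auto
qed

section \<open>Lengths within a signature and across signatures\<close>

text \<open>If \<open>b\<close> were at least 3 bits longer than \<open>a\<close>, lengthening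
  \<open>a\<close> by one bit would free at least four times the Kraft weight of \<open>b\<close>,
  while shortening \<open>b\<close> by two bits uses only three times. With equal probabilities this
  is a strict gain; shortening by one bit would only give a tie.\<close>

lemma same_signature_length_le:
  assumes q: "0 < q" "q < 1" and opt: "optimal_code q T"
    and sig: "fst a + snd a = fst b + snd b"
  shows "length (T b) \<le> length (T a) + 2"
proof (rule ccontr)
  assume *: "\<not> ?thesis"
  then have ab: "a \<noteq> b" by auto
  have "(1/2) ^ length (T b) \<le> (1/2 :: real) ^ (length (T a) + 3)"
    using * by (intro power_decreasing) auto
  moreover have "(1/2 :: real) ^ (length (T a) + 3) = (1/2) ^ length (T a) / 8"
    by (simp add: power_add power3_eq_cube)
  moreover have "0 \<le> (1/2 :: real) ^ length (T a)" by simp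
  ultimately have "3 * (1/2) ^ length (T b) \<le> (1/2) ^ length (T a) / (2::real)"
    by linarith
  then have "2 * q ^ (fst b + snd b) \<le> q ^ (fst a + snd a)"
    using optimal_code_exchange[OF q opt, of "{a}" "{b}" 2] ab * by auto
  with sig show False using q by simp
qed

text \<open>Otherwise, lengthening all \<open>2 ^ k\<close> symbols of \<open>S\<close> by one bit
  frees enough Kraft weight to shorten the more probable \<open>b\<close> by one bit.\<close>

lemma length_add_le:
  assumes q: "0 < q" "q < 1" and opt: "optimal_code q T"
    and S: "finite S" "card S = 2 ^ k" "\<And>a. a \<in> S \<Longrightarrow> fst a + snd a = s"
    and M: "\<And>a. a \<in> S \<Longrightarrow> length (T a) \<le> M"
    and b: "b \<notin> S" and less: "2 ^ k * q ^ s < q ^ (fst b + snd b)"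
  shows "length (T b) + k \<le> M"
proof (rule ccontr)
  assume *: "\<not> ?thesis"
  have pf: "prefix_free T"
    using opt by (simp add: optimal_code_def full_prefix_codeD)
  \<comment> \<open>A word can be shortened only if it is nonempty; any second symbol, here a
    neighbour of \<open>b\<close>, guarantees this.\<close>
  have pos: "length (T b) \<ge> 1"
    by (rule prefix_free_length_pos[OF pf, of _ "(Suc (fst b), snd b)"]) (metis fst_conv n_not_Suc_n)
  have "(1/2 :: real) ^ (length (T b) + k) \<le> (1/2) ^ (M + 1)"
    using * by (intro power_decreasing) auto
  then have "(1/2 :: real) ^ length (T b) \<le> (2 ^ k * (1/2) ^ M) / 2"
    by (simp add: power_add power_divide field_simps)
  also have "2 ^ k * (1/2) ^ M = (\<Sum>a\<in>S. (1/2 :: real) ^ M)"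
    using S by simp
  also have "\<dots> \<le> (\<Sum>a\<in>S. (1/2) ^ length (T a))"
    using M by (intro sum_mono power_decreasing) auto
  finally have "(1/2 :: real) ^ length (T b) \<le> (\<Sum>a\<in>S. (1/2) ^ length (T a)) / 2" by simp
  then have "q ^ (fst b + snd b) \<le> (\<Sum>a\<in>S. q ^ (fst a + snd a))"
    using optimal_code_exchange[OF q opt S(1), of "{b}" 1] b pos by simp
  also have "\<dots> = 2 ^ k * q ^ s" using S by simp
  finally show False using less by simp
qed

text \<open>The opposite exchange: \<open>b\<close> is lengthened by one bit, and half of its Kraft
  weight pays for shortening all of \<open>S\<close>.\<close>

lemma length_le_add:
  assumes q: "0 < q" "q < 1" and opt: "optimal_code q T"
    and S: "finite S" "card S = 2 ^ k" "\<And>a. a \<in> S \<Longrightarrow> fst a + snd a = s"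
    and L: "\<And>a. a \<in> S \<Longrightarrow> L \<le> length (T a)"
    and b: "b \<notin> S" and less: "q ^ (fst b + snd b) < 2 ^ k * q ^ s"
  shows "L \<le> length (T b) + k"
proof (rule ccontr)
  assume *: "\<not> ?thesis"
  have "(\<Sum>a\<in>S. (1/2) ^ length (T a)) \<le> (\<Sum>a\<in>S. (1/2 :: real) ^ L)"
    using L by (intro sum_mono power_decreasing) auto
  also have "\<dots> = 2 ^ k * (1/2) ^ L" using S by simp
  also have "\<dots> \<le> 2 ^ k * (1/2) ^ (length (T b) + k + 1)"
    using * by (intro mult_left_mono power_decreasing) auto
  also have "\<dots> = (1/2) ^ length (T b) / 2"
    by (simp add: power_add power_divide field_simps)
  finally have "(\<Sum>a\<in>S. (1/2) ^ length (T a)) \<le> (1/2 :: real) ^ length (T b) / 2" .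
  moreover have "1 \<le> length (T a)" if "a \<in> S" for a
    using L[OF that] * by simp
  ultimately have "(\<Sum>a\<in>S. q ^ (fst a + snd a)) \<le> q ^ (fst b + snd b)"
    using optimal_code_exchange[OF q opt _ S(1), of "{b}" 1] b by simp
  also have "(\<Sum>a\<in>S. q ^ (fst a + snd a)) = 2 ^ k * q ^ s" using S by simp
  finally show False using less by simp
qed

section \<open>Separating two parameters\<close>

text \<open>Choose \<open>n\<close> with \<open>q1 ^ n\<close> more than 64 times
  \<open>q ^ n\<close>, and \<open>k\<close> least with \<open>1 < 2 ^ k * q1 ^ n\<close>. Then
  \<open>2 ^ (k - 1) * q1 ^ n\<close> is at most 1, and the factor \<open>64 = 2 ^ 6\<close> raises
  the exponent from \<open>k - 1\<close> to \<open>k + 5\<close>.\<close>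

lemma exists_separating_powers:
  fixes q q1 :: real
  assumes "0 < q" "q < q1" "q1 < 1"
  obtains n k where "2 ^ (k + 5) * q ^ n < 1" "1 < 2 ^ k * q1 ^ n" "n > 0"
proof -
  have q1: "0 < q1" using assms by simp
  obtain n where n: "64 < (q1 / q) ^ n"
    using real_arch_pow[of "q1 / q" 64] assms by auto
  have "n > 0" using n by (cases n) auto
  define P where "P k \<longleftrightarrow> 1 < 2 ^ k * q1 ^ n" for k
  obtain k0 where "1 / q1 ^ n < 2 ^ k0"
    using real_arch_pow[of 2 "1 / q1 ^ n"] by auto
  then have "P k0" using q1 by (simp add: P_def field_simps)
  then have k: "P (LEAST k. P k)" by (rule LeastI)
  define k where "k = (LEAST k. P k)"
  have "\<not> P 0" using assms q1 by (simp add: P_def not_less power_le_one)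
  with k obtain m where m: "k = Suc m" unfolding k_def by (metis not0_implies_Suc)
  then have "\<not> P m" using not_less_Least[of m P] by (simp add: k_def)
  then have "2 ^ m * q1 ^ n \<le> 1" by (simp add: P_def)
  moreover have "64 * q ^ n < q1 ^ n"
    using n assms by (simp add: power_divide field_simps)
  then have "2 ^ m * (64 * q ^ n) < 2 ^ m * q1 ^ n" by simp
  ultimately have "2 ^ m * (64 * q ^ n) < 1" by (rule order.strict_trans2[rotated])
  then have "2 ^ (k + 5) * q ^ n < 1" by (simp add: m power_add)
  with k \<open>n > 0\<close> show ?thesis using that by (simp add: P_def k_def)
qed

lemma not_optimal_code_both:
  assumes q: "0 < q" "q < q1" "q1 < 1"
    and opt: "optimal_code q T" and opt1: "optimal_code q1 T"
  shows False
proof -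
  obtain n k where k: "2 ^ (k + 5) * q ^ n < 1" "1 < 2 ^ k * q1 ^ n" and n: "n > 0"
    using exists_separating_powers[OF q] by blast
  \<comment> \<open>So large that signature \<open>s\<close> contains the \<open>2 ^ (k + 5)\<close>
    symbols needed for the first exchange.\<close>
  define t :: nat where "t = 2 ^ (k + 5)"
  define s where "s = t + n"
  define S where "S r = (\<lambda>i. (i, s - i)) ` {..<(2::nat) ^ r}" for r
  have finS: "finite (S r)" and cardS: "card (S r) = 2 ^ r" for r
    by (auto simp: S_def card_image inj_on_def)
  have sig: "fst a + snd a = s" if "a \<in> S r" "r \<le> k + 5" for a r
  proof -
    \<comment> \<open>This bound makes the subtraction \<open>s - i\<close> in \<open>S r\<close>
      exact.\<close>
    have "(2::nat) ^ r \<le> 2 ^ (k + 5)" using that(2) by (intro power_increasing) auto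
    then have "2 ^ r \<le> s" unfolding s_def t_def by (rule trans_le_add1)
    then show ?thesis using that(1) by (auto simp: S_def)
  qed
  define x where "x = length (T (0, s))"
  have up: "length (T a) \<le> x + 2" if "fst a + snd a = s" for a
    unfolding x_def using that q
    by (intro same_signature_length_le[OF _ _ opt]) auto
  have lo: "x - 2 \<le> length (T a)" if "fst a + snd a = s" for a
    using same_signature_length_le[OF _ _ opt, of a "(0, s)"] that q by (simp add: x_def)
  have b: "(0, t) \<notin> S r" if "r \<le> k + 5" for r
    using sig[of "(0, t)" r] that n by (auto simp: s_def)
  \<comment> \<open>Optimality for \<open>q\<close> forces growth by at least \<open>k + 3\<close>
    from \<open>(0, t)\<close> to \<open>(0, s)\<close>; optimality for \<open>q1\<close> allows at
    most \<open>k + 2\<close>. The margin 5 just exceeds the total slack 2 + 2 within a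
    signature.\<close>
  have "length (T (0, t)) + (k + 5) \<le> x + 2"
    by (rule length_add_le[OF _ _ opt finS cardS])
      (use q k(1) sig up b in \<open>auto simp: s_def power_add\<close>)
  moreover have "x - 2 \<le> length (T (0, t)) + k"
    by (rule length_le_add[OF _ _ opt1 finS cardS])
      (use q k(2) sig lo b in \<open>auto simp: s_def power_add\<close>)
  ultimately show False by simp
qed

theorem theorem1:
  fixes q q1 :: real and T :: "nat \<times> nat \<Rightarrow> bool list"
  assumes "0 < q" "q < 1" "0 < q1" "q1 < 1" "q \<noteq> q1"
    and "optimal_code q T"
  shows "\<not> optimal_code q1 T"
  using assms not_optimal_code_both[of q q1 T] not_optimal_code_both[of q1 q T]
  by (meson linorder_neqE)

end
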